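(* Let $(G,F)$ be a similarity GIFS with $\lambda(f_e)=s^{d(e)}$ for all $e\in E$, and let $\overleftarrow{\theta}\in\overleftarrow{\Sigma}^\infty$ be a filling parameter. If $\overleftarrow{\theta}$ is eventually periodic, then the balanced GIFS tiling $T(\overleftarrow{\theta})$ is self-similar.
   Context: GIFS. Let $G=(V,E)$ be a finite strongly connected directed graph with $V=\{1,\dots,n\}$, loops and multiple edges allowed. An edge $e$ goes from its tail $e^-$ to its head $e^+$, and $E_i=\{e\in E: e^-=i\}$. A path is directed, is written as its string of edges, may repeat vertices and edges, and may have length zero (a single vertex); $\sigma^-$ is its starting vertex and, for finite $\sigma$, $\sigma^+$ is its terminal vertex. $\Sigma^*$ is the set of finite paths in $G$. A GIFS $(G,F)$ on $\mathbb{R}^d$ consists of $G$ and an invertible contraction $f_e:\mathbb{R}^d\to\mathbb{R}^d$ for each $e\in E$. For $\sigma=\sigma_1\cdots\sigma_k\in\Sigma^*$ put $f_\sigma=f_{\sigma_1}\circ\cdots\circ f_{\sigma_k}$ (the identity if $k=0$). There is a unique $n$-tuple $(A_1,\dots,A_n)$ of nonempty compact sets (the components of the attractor) with $A_i=\bigcup_{e\in E_i}f_e(A_{e^+})$ for all $i$. Standing assumptions: each $A_i$ has nonempty interior, and for each $i$ and distinct $e,e'\in E_i$ the set $f_e(A_{e^+})\cap f_{e'}(A_{e'^+})$ has empty interior. Tilings. A tile is a compact subset of $\mathbb{R}^d$ with nonempty interior; a tiling of $X\subseteq\mathbb{R}^d$ is a set of tiles, pairwise non-overlapping (the intersection of two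 distinct tiles has empty interior), whose union is $X$. A tiling $T$ is self-similar if there is a similarity transformation $\phi:\mathbb{R}^d\to\mathbb{R}^d$ with scaling ratio greater than $1$ such that, for every tile $t\in T$, the image $\phi(t)$ is tiled by tiles in $T$. Pre-trees. A subpath of $\sigma_1\cdots\sigma_k$ is an initial segment $\sigma_1\cdots\sigma_j$ with $0\le j\le k$ (for $j=0$, the single starting vertex); it is proper if $j<k$. A pre-tree is a finite nonempty set $S$ of finite paths in $G$ such that (i) all paths in $S$ begin at the same vertex, the root of $S$; (ii) no proper subpath of a path in $S$ lies in $S$; (iii) if $\sigma$ is a proper subpath of a path in $S$ and $e\in E$ has $e^-=\sigma^+$, then $\sigma e$ is a subpath of a path in $S$. Parameters. Let $\overleftarrow{G}$ be $G$ with all edges reversed, $\overleftarrow{e}$ the reversal of $e$, $\overleftarrow{\Sigma}^*$ and $\overleftarrow{\Sigma}^\infty$ the sets of finite and infinite paths in $\overleftarrow{G}$, $f_{\overleftarrow{e}}=f_e^{-1}$, and $f_{\overleftarrow{e_1}\cdots\overleftarrow{e_k}}=f_{\overleftarrow{e_1}}\circ\cdots\circ f_{\overleftarrow{e_k}}$. A parameter is an element $\overleftarrow{\theta}=\overleftarrow{\theta}_1\overleftarrow{\theta}_2\cdots$ of $\overleftarrow{\Sigma}^\infty$, with successive vertices $v_0,v_1,v_2,\dots$; $\theta_k\in E$ is the edge of $G$ with reversal $\overleftarrow{\theta}_k$ (so $\theta_k$ goes from $v_k$ to $v_{k-1}$), and $\overleftarrow{\theta}|k=\overleftarrow{\theta}_1\cdots\overleftarrow{\theta}_k$.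 A $\overleftarrow{\theta}$-sequence is a sequence $\mathcal{S}=\{S_0,S_1,\dots\}$ of pre-trees such that $S_k$ has root $v_k$ for all $k\ge0$ and $\theta_kS_{k-1}:=\{\theta_k\sigma:\sigma\in S_{k-1}\}\subset S_k$ for all $k\ge1$. Put $T(\overleftarrow{\theta},\mathcal{S},k)=\{f_{\overleftarrow{\theta}|k}\circ f_\sigma(A_{\sigma^+}):\sigma\in S_k\}$ and $T(\overleftarrow{\theta},\mathcal{S})=\bigcup_{k\ge0}T(\overleftarrow{\theta},\mathcal{S},k)$. The parameter $\overleftarrow{\theta}$ is filling if, for every $\overleftarrow{\theta}$-sequence $\mathcal{S}$, the union of the sets in $T(\overleftarrow{\theta},\mathcal{S})$ is $\mathbb{R}^d$. The parameter $\overleftarrow{\theta}$ is eventually periodic if $\overleftarrow{\theta}=\beta\,\alpha\,\alpha\,\alpha\cdots$ for some $\alpha,\beta\in\overleftarrow{\Sigma}^*$ with $\alpha$ a closed path of positive length. Balanced tilings. Each $f_e$ is a similarity with scaling ratio $\lambda(f_e)$, and there are a fixed real $s>0$ (the scaling constant) and fixed positive integers $d(e)$ with $\lambda(f_e)=s^{d(e)}$ for all $e\in E$. Put $d(\overleftarrow{e})=d(e)$; for a finite path $\sigma$ in $G$ or $\overleftarrow{G}$, $d(\sigma)$ is the sum of the values $d(e)$ over its edges (with multiplicity), and $\sigma_*$ is the last edge of a path $\sigma\in\Sigma^*$ of positive length. The balanced sequence $\mathcal{S}(\overleftarrow{\theta})=(S_0,S_1,\dots)$ has $S_k$ equal to the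 set of positive-length $\sigma\in\Sigma^*$ with $\sigma^-=v_k$ and $0<d(\sigma)-d(\overleftarrow{\theta}|k)\le d(\sigma_* )$. For filling $\overleftarrow{\theta}$, the balanced GIFS tiling is $T(\overleftarrow{\theta}):=T(\overleftarrow{\theta},\mathcal{S}(\overleftarrow{\theta}))$. *)

theory Defs
  imports
    "HOL-Analysis.Analysis"
    "HOL-Library.Stream"
    "HOL-Library.Sublist"
    "Graph_Theory.Digraph_Component"
begin

definition similarity :: "real \<Rightarrow> (real^'n \<Rightarrow> real^'n) \<Rightarrow> bool" where
  "similarity r \<phi> \<longleftrightarrow> r > 0 \<and> (\<forall>x y. dist (\<phi> x) (\<phi> y) = r * dist x y)"

definition tile :: "(real^'n) set \<Rightarrow> bool" where
  "tile t \<longleftrightarrow> compact t \<and> interior t \<noteq> {}"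

definition tiling_of :: "(real^'n) set \<Rightarrow> (real^'n) set set \<Rightarrow> bool" where
  "tiling_of X T \<longleftrightarrow>
     (\<forall>t\<in>T. tile t) \<and>
     (\<forall>t\<in>T. \<forall>t'\<in>T. t \<noteq> t' \<longrightarrow> interior (t \<inter> t') = {}) \<and>
     \<Union>T = X"

definition self_similar :: "(real^'n) set set \<Rightarrow> bool" where
  "self_similar T \<longleftrightarrow>
     (\<exists>X. tiling_of X T) \<and>
     (\<exists>\<phi> r. r > 1 \<and> similarity r \<phi> \<and> (\<forall>t\<in>T. \<exists>T'\<subseteq>T. tiling_of (\<phi> ` t) T'))"

text \<open>A finite path is a pair of its starting vertex and its list of edges; the vertex
  is needed to distinguish the paths of length zero.\<close>

type_synonym ('v, 'e) path = "'v \<times> 'e list"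

definition finite_paths :: "('v, 'e) pre_digraph \<Rightarrow> ('v, 'e) path set" where
  "finite_paths G = {(u, p). \<exists>v. pre_digraph.awalk G u p v}"

abbreviation path_start :: "('v, 'e) path \<Rightarrow> 'v" where
  "path_start \<sigma> \<equiv> fst \<sigma>"

definition path_end :: "('v, 'e) pre_digraph \<Rightarrow> ('v, 'e) path \<Rightarrow> 'v" where
  "path_end G \<sigma> = last (pre_digraph.awalk_verts G (fst \<sigma>) (snd \<sigma>))"

definition subpath :: "('v, 'e) path \<Rightarrow> ('v, 'e) path \<Rightarrow> bool" where
  "subpath \<sigma> \<tau> \<longleftrightarrow> fst \<sigma> = fst \<tau> \<and> prefix (snd \<sigma>) (snd \<tau>)"

definition proper_subpath :: "('v, 'e) path \<Rightarrow> ('v, 'e) path \<Rightarrow> bool" where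
  "proper_subpath \<sigma> \<tau> \<longleftrightarrow> fst \<sigma> = fst \<tau> \<and> strict_prefix (snd \<sigma>) (snd \<tau>)"

definition cons_edge :: "('v, 'e) pre_digraph \<Rightarrow> 'e \<Rightarrow> ('v, 'e) path \<Rightarrow> ('v, 'e) path" where
  "cons_edge G e \<sigma> = (tail G e, e # snd \<sigma>)"

definition path_map :: "('e \<Rightarrow> 'a \<Rightarrow> 'a) \<Rightarrow> 'e list \<Rightarrow> 'a \<Rightarrow> 'a" where
  "path_map g p = foldr (\<lambda>e h. g e \<circ> h) p id"

definition path_weight :: "('e \<Rightarrow> nat) \<Rightarrow> 'e list \<Rightarrow> nat" where
  "path_weight d p = sum_list (map d p)"

definition pre_tree ::
  "('v, 'e) pre_digraph \<Rightarrow> 'v \<Rightarrow> ('v, 'e) path set \<Rightarrow> bool" \<comment> \<open>with a given root\<close> where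
  "pre_tree G v S \<longleftrightarrow>
     finite S \<and> S \<noteq> {} \<and> S \<subseteq> finite_paths G \<and>
     (\<forall>\<sigma>\<in>S. path_start \<sigma> = v) \<and>
     (\<forall>\<tau>\<in>S. \<forall>\<sigma>. proper_subpath \<sigma> \<tau> \<longrightarrow> \<sigma> \<notin> S) \<and>
     (\<forall>\<tau>\<in>S. \<forall>\<sigma>. \<forall>e\<in>arcs G. proper_subpath \<sigma> \<tau> \<and> tail G e = path_end G \<sigma> \<longrightarrow>
        (\<exists>\<tau>'\<in>S. subpath (fst \<sigma>, snd \<sigma> @ [e]) \<tau>'))"

text \<open>The component \<^term>\<open>A i\<close> of the attractor is a parameter of the locale; on the
  vertices of the graph it is uniquely determined by the three assumptions on it that
  follow the ones on \<^term>\<open>f\<close>. The last two assumptions are the standing ones on the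
  attractor.\<close>

locale gifs = fin_digraph G for G :: "('v, 'e) pre_digraph" +
  fixes f :: "'e \<Rightarrow> real^'n \<Rightarrow> real^'n"
    and A :: "'v \<Rightarrow> (real^'n) set"
  assumes strongly_connected: "strongly_connected G"
    and contraction: "e \<in> arcs G \<Longrightarrow> \<exists>c<1. c-lipschitz_on UNIV (f e)"
    and invertible: "e \<in> arcs G \<Longrightarrow> bij (f e)"
    and attractor_nonempty: "i \<in> verts G \<Longrightarrow> A i \<noteq> {}"
    and attractor_compact: "i \<in> verts G \<Longrightarrow> compact (A i)"
    and attractor_eq: "i \<in> verts G \<Longrightarrow> A i = (\<Union>e\<in>out_arcs G i. f e ` A (head G e))"
    and attractor_interior: "i \<in> verts G \<Longrightarrow> interior (A i) \<noteq> {}"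
    and attractor_nonoverlap:
      "\<lbrakk>i \<in> verts G; e \<in> out_arcs G i; e' \<in> out_arcs G i; e \<noteq> e'\<rbrakk> \<Longrightarrow>
         interior (f e ` A (head G e) \<inter> f e' ` A (head G e')) = {}"

locale similarity_gifs = gifs G f A
  for G :: "('v, 'e) pre_digraph"
    and f :: "'e \<Rightarrow> real^'n \<Rightarrow> real^'n"
    and A :: "'v \<Rightarrow> (real^'n) set" +
  fixes s :: real and d :: "'e \<Rightarrow> nat"
  assumes scaling_constant_pos: "s > 0"
    and exponent_pos: "e \<in> arcs G \<Longrightarrow> d e > 0"
    and similarity: "e \<in> arcs G \<Longrightarrow> similarity (s ^ d e) (f e)"

text \<open>The reversal of an edge is represented by the edge itself, regarded as an edge of
  the reversed graph. A parameter \<open>\<theta>\<close> is a stream indexed from 0, so that its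
  \<open>k\<close>-th edge is \<^term>\<open>\<theta> !! (k - 1)\<close>.\<close>

definition reverse_graph :: "('v, 'e) pre_digraph \<Rightarrow> ('v, 'e) pre_digraph" where
  "reverse_graph G = \<lparr>verts = verts G, arcs = arcs G, tail = head G, head = tail G\<rparr>"

definition infinite_path :: "('v, 'e) pre_digraph \<Rightarrow> 'e stream \<Rightarrow> bool" where
  "infinite_path G \<theta> \<longleftrightarrow>
     sset \<theta> \<subseteq> arcs G \<and> (\<forall>k. head G (\<theta> !! k) = tail G (\<theta> !! Suc k))"

definition parameter :: "('v, 'e) pre_digraph \<Rightarrow> 'e stream \<Rightarrow> bool" where
  "parameter G \<theta> \<longleftrightarrow> infinite_path (reverse_graph G) \<theta>"

primrec param_vertex :: "('v, 'e) pre_digraph \<Rightarrow> 'e stream \<Rightarrow> nat \<Rightarrow> 'v" where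
  "param_vertex G \<theta> 0 = tail (reverse_graph G) (\<theta> !! 0)"
| "param_vertex G \<theta> (Suc k) = head (reverse_graph G) (\<theta> !! k)"

definition eventually_periodic :: "('v, 'e) pre_digraph \<Rightarrow> 'e stream \<Rightarrow> bool" where
  "eventually_periodic G \<theta> \<longleftrightarrow>
     (\<exists>\<beta> \<alpha> u v. pre_digraph.awalk (reverse_graph G) u \<beta> v \<and>
        pre_digraph.awalk (reverse_graph G) v \<alpha> v \<and> \<alpha> \<noteq> [] \<and> \<theta> = \<beta> @- cycle \<alpha>)"

definition theta_sequence ::
  "('v, 'e) pre_digraph \<Rightarrow> 'e stream \<Rightarrow> (nat \<Rightarrow> ('v, 'e) path set) \<Rightarrow> bool" where
  "theta_sequence G \<theta> S \<longleftrightarrow>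
     (\<forall>k. pre_tree G (param_vertex G \<theta> k) (S k)) \<and>
     (\<forall>k. cons_edge G (\<theta> !! k) ` S k \<subseteq> S (Suc k))"

definition level_tiles ::
  "('v, 'e) pre_digraph \<Rightarrow> ('e \<Rightarrow> real^'n \<Rightarrow> real^'n) \<Rightarrow> ('v \<Rightarrow> (real^'n) set) \<Rightarrow>
   'e stream \<Rightarrow> (nat \<Rightarrow> ('v, 'e) path set) \<Rightarrow> nat \<Rightarrow> (real^'n) set set" where
  "level_tiles G f A \<theta> S k =
     (\<lambda>\<sigma>. (path_map (\<lambda>e. inv (f e)) (stake k \<theta>) \<circ> path_map f (snd \<sigma>)) ` A (path_end G \<sigma>)) ` S k"

definition gifs_tiles ::
  "('v, 'e) pre_digraph \<Rightarrow> ('e \<Rightarrow> real^'n \<Rightarrow> real^'n) \<Rightarrow> ('v \<Rightarrow> (real^'n) set) \<Rightarrow>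
   'e stream \<Rightarrow> (nat \<Rightarrow> ('v, 'e) path set) \<Rightarrow> (real^'n) set set" where
  "gifs_tiles G f A \<theta> S = (\<Union>k. level_tiles G f A \<theta> S k)"

definition filling ::
  "('v, 'e) pre_digraph \<Rightarrow> ('e \<Rightarrow> real^'n \<Rightarrow> real^'n) \<Rightarrow> ('v \<Rightarrow> (real^'n) set) \<Rightarrow>
   'e stream \<Rightarrow> bool" where
  "filling G f A \<theta> \<longleftrightarrow> (\<forall>S. theta_sequence G \<theta> S \<longrightarrow> \<Union>(gifs_tiles G f A \<theta> S) = UNIV)"

definition balanced_sequence ::
  "('v, 'e) pre_digraph \<Rightarrow> ('e \<Rightarrow> nat) \<Rightarrow> 'e stream \<Rightarrow> nat \<Rightarrow> ('v, 'e) path set" where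
  "balanced_sequence G d \<theta> k =
     {\<sigma> \<in> finite_paths G. snd \<sigma> \<noteq> [] \<and> path_start \<sigma> = param_vertex G \<theta> k \<and>
        0 < int (path_weight d (snd \<sigma>)) - int (path_weight d (stake k \<theta>)) \<and>
        int (path_weight d (snd \<sigma>)) - int (path_weight d (stake k \<theta>)) \<le> int (d (last (snd \<sigma>)))}"

definition balanced_tiling ::
  "('v, 'e) pre_digraph \<Rightarrow> ('e \<Rightarrow> real^'n \<Rightarrow> real^'n) \<Rightarrow> ('v \<Rightarrow> (real^'n) set) \<Rightarrow>
   ('e \<Rightarrow> nat) \<Rightarrow> 'e stream \<Rightarrow> (real^'n) set set" where
  "balanced_tiling G f A d \<theta> = gifs_tiles G f A \<theta> (balanced_sequence G d \<theta>)"

end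

theory Submission
  imports Defs
begin

text \<open>
  Write \<open>g\<^sub>k\<close> for the expanding map attached to the first \<open>k\<close> edges of the parameter. The
  balanced tiles of level \<open>k\<close> are the sets \<open>g\<^sub>k (f\<^sub>\<sigma> (A v))\<close>, where \<open>\<sigma>\<close> runs from \<open>v\<^sub>k\<close> to \<open>v\<close>
  and is stopped as soon as its weight exceeds \<open>N\<^sub>k\<close>, the weight of those \<open>k\<close> edges. Such a
  stopping rule, studied below as \<open>first_passage\<close>, has two consequences. No stopped path
  extends another, so two of them separate at an edge, where the non-overlap of the
  attractor applies (\<open>interior_cell_Int_empty\<close>). And a path that has not overshot a larger
  threshold can be continued until it passes that threshold, so its cell is the union of
  the cells of the continuations (\<open>cell_eq_Union_first_passage\<close>).

  Let the parameter be \<open>\<beta>\<alpha>\<alpha>\<dots>\<close>, let \<open>l\<close> be the length of \<open>\<alpha>\<close>, and let \<open>g\<^sub>\<beta>\<close>, \<open>g\<^sub>\<alpha>\<close> be the expanding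
  maps of \<open>\<beta>\<close> and \<open>\<alpha>\<close>. Self-similarity is witnessed by the conjugate
  \<open>\<phi> = g\<^sub>\<beta> \<circ> g\<^sub>\<alpha> \<circ> g\<^sub>\<beta>\<^sup>-\<^sup>1\<close>, because inserting one more period gives
  \<open>\<phi> \<circ> g\<^sub>k = g\<^bsub>k+l\<^esub>\<close> once \<open>k\<close> is at least the length of \<open>\<beta>\<close>. The levels are nested
  (\<open>level_tiles_mono\<close>), so every tile occurs as \<open>g\<^sub>k (f\<^sub>\<sigma> (A v))\<close> with \<open>k\<close> that large; its
  image is \<open>g\<^bsub>k+l\<^esub> (f\<^sub>\<sigma> (A v))\<close>, and \<open>v\<^bsub>k+l\<^esub> = v\<^sub>k\<close>, so continuing \<open>\<sigma>\<close> up to the threshold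
  \<open>N\<^bsub>k+l\<^esub>\<close> splits the image into tiles of level \<open>k + l\<close>.
\<close>

section \<open>Similarities of Euclidean space\<close>

lemma similarity_comp:
  assumes "similarity a g" "similarity b h"
  shows "similarity (a * b) (g \<circ> h)"
  using assms by (auto simp: similarity_def)

lemma similarity_inv:
  assumes "similarity a g" "bij g"
  shows "similarity (inverse a) (inv g)"
proof -
  have "dist (inv g x) (inv g y) = inverse a * dist x y" for x y
  proof -
    have "dist x y = dist (g (inv g x)) (g (inv g y))"
      using assms(2) by (simp add: bij_is_surj surj_f_inv_f)
    also have "\<dots> = a * dist (inv g x) (inv g y)"
      using assms(1) by (simp add: similarity_def)
    finally show ?thesis
      using assms(1) by (simp add: similarity_def field_simps)
  qed
  then show ?thesis using assms(1) by (simp add: similarity_def)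
qed

lemma similarity_continuous_on: "similarity a g \<Longrightarrow> continuous_on S g"
  by (rule lipschitz_on_continuous_on[of a]) (auto simp: similarity_def lipschitz_on_def)

lemma image_interior_subset_similarity:
  assumes "similarity a g" "bij g"
  shows "g ` interior S \<subseteq> interior (g ` S)"
proof (rule interior_maximal)
  show "g ` interior S \<subseteq> g ` S" by (intro image_mono interior_subset)
  have "open (inv g -` interior S)"
    using similarity_continuous_on[OF similarity_inv[OF assms], of UNIV]
    by (intro open_vimage) auto
  then show "open (g ` interior S)"
    using assms(2) by (simp add: bij_vimage_eq_inv_image bij_imp_bij_inv inv_inv_eq)
qed

lemma interior_image_empty_iff_similarity:
  assumes "similarity a g" "bij g"
  shows "interior (g ` S) = {} \<longleftrightarrow> interior S = {}"
proof -
  have "inv g ` interior (g ` S) \<subseteq> interior (inv g ` (g ` S))"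
    by (rule image_interior_subset_similarity)
       (auto intro: similarity_inv[OF assms] bij_imp_bij_inv assms(2))
  moreover have "inv g ` (g ` S) = S"
    using assms(2) by (simp add: bij_is_inj image_inv_f_f)
  ultimately show ?thesis
    using image_interior_subset_similarity[OF assms, of S] by auto
qed

lemma tile_image_similarity:
  assumes "similarity a g" "bij g" "tile t"
  shows "tile (g ` t)"
  using assms compact_continuous_image[OF similarity_continuous_on[OF assms(1)]]
  by (simp add: tile_def interior_image_empty_iff_similarity)

lemma tiling_of_subset:
  assumes "tiling_of X T" "T' \<subseteq> T"
  shows "tiling_of (\<Union>T') T'"
  using assms by (simp add: tiling_of_def subset_iff)

section \<open>Maps attached to paths\<close>

lemma path_map_Nil [simp]: "path_map g [] = id"
  and path_map_Cons [simp]: "path_map g (e # p) = g e \<circ> path_map g p"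
  by (simp_all add: path_map_def)

lemma path_map_append [simp]: "path_map g (p @ q) = path_map g p \<circ> path_map g q"
  by (induction p) (simp_all add: comp_assoc)

lemma path_weight_simps [simp]:
  "path_weight d [] = 0"
  "path_weight d (e # p) = d e + path_weight d p"
  "path_weight d (p @ q) = path_weight d p + path_weight d q"
  by (simp_all add: path_weight_def)

lemma bij_path_map: "(\<And>e. e \<in> set p \<Longrightarrow> bij (g e)) \<Longrightarrow> bij (path_map g p)"
  by (induction p) (auto intro: bij_comp)

lemma similarity_path_map:
  assumes "\<And>e. e \<in> set p \<Longrightarrow> similarity (r ^ d e) (g e)"
  shows "similarity (r ^ path_weight d p) (path_map g p)"
  using assms
proof (induction p)
  case Nil
  then show ?case by (simp add: similarity_def)
next
  case (Cons e p)
  then have "similarity (r ^ d e) (g e)" "similarity (r ^ path_weight d p) (path_map g p)"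
    by simp_all
  from similarity_comp[OF this] show ?case
    by (simp only: path_map_Cons path_weight_simps power_add)
qed

section \<open>Cells and first passages\<close>

text \<open>The paths from \<open>u\<close> stopped at the first moment their weight exceeds \<open>N\<close>: the last edge is
  the one that crosses the threshold.\<close>

definition first_passage ::
  "('v, 'e) pre_digraph \<Rightarrow> ('e \<Rightarrow> nat) \<Rightarrow> 'v \<Rightarrow> nat \<Rightarrow> ('v, 'e) path set" where
  "first_passage G d u N = {\<sigma> \<in> finite_paths G. snd \<sigma> \<noteq> [] \<and> fst \<sigma> = u \<and>
     N < path_weight d (snd \<sigma>) \<and> path_weight d (snd \<sigma>) \<le> N + d (last (snd \<sigma>))}"

definition cell ::
  "('v, 'e) pre_digraph \<Rightarrow> ('e \<Rightarrow> real^'n \<Rightarrow> real^'n) \<Rightarrow> ('v \<Rightarrow> (real^'n) set) \<Rightarrow>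
   ('v, 'e) path \<Rightarrow> (real^'n) set" where
  "cell G f A \<sigma> = path_map f (snd \<sigma>) ` A (path_end G \<sigma>)"

lemma balanced_sequence_eq_first_passage:
  "balanced_sequence G d \<theta> k =
     first_passage G d (param_vertex G \<theta> k) (path_weight d (stake k \<theta>))"
  by (auto simp: balanced_sequence_def first_passage_def)

lemma level_tiles_eq_cells:
  "level_tiles G f A \<theta> S k =
     (\<lambda>\<sigma>. path_map (\<lambda>e. inv (f e)) (stake k \<theta>) ` cell G f A \<sigma>) ` S k"
  by (simp add: level_tiles_def cell_def image_comp)

text \<open>Strict prefixes of a first passage have not yet crossed the threshold.\<close>

lemma first_passage_parallel:
  assumes "\<sigma> \<in> first_passage G d u N" "\<tau> \<in> first_passage G d u N" "\<sigma> \<noteq> \<tau>"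
  shows "snd \<sigma> \<parallel> snd \<tau>"
proof -
  have no_prefix: "\<not> prefix (snd \<sigma>) (snd \<tau>)"
    if "\<sigma> \<in> first_passage G d u N" "\<tau> \<in> first_passage G d u N" "\<sigma> \<noteq> \<tau>"
    for \<sigma> \<tau> :: "('a, 'b) path"
  proof
    assume "prefix (snd \<sigma>) (snd \<tau>)"
    then obtain q where q: "snd \<tau> = snd \<sigma> @ q" by (auto elim: prefixE)
    have "q \<noteq> []"
      using that q by (auto simp: first_passage_def prod_eq_iff)
    then obtain q' e where "q = q' @ [e]" by (metis rev_exhaust)
    then show False using that q by (auto simp: first_passage_def)
  qed
  show ?thesis
    using no_prefix[OF assms] no_prefix[OF assms(2,1)] assms(3) by (auto intro!: parallelI)
qed

context similarity_gifs
begin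

lemma path_end_eq: "awalk u p v \<Longrightarrow> path_end G (u, p) = v"
  by (simp add: path_end_def)

lemma finite_paths_iff: "(u, p) \<in> finite_paths G \<longleftrightarrow> awalk u p (path_end G (u, p))"
  by (auto simp: finite_paths_def path_end_eq)

lemma cell_eq: "awalk u p v \<Longrightarrow> cell G f A (u, p) = path_map f p ` A v"
  by (simp add: cell_def path_end_eq)

lemma bij_path_map_f: "set p \<subseteq> arcs G \<Longrightarrow> bij (path_map f p)"
  using invertible by (intro bij_path_map) auto

lemma similarity_path_map_f:
  "set p \<subseteq> arcs G \<Longrightarrow> similarity (s ^ path_weight d p) (path_map f p)"
  using similarity by (intro similarity_path_map) auto

lemma bij_path_map_inv: "set p \<subseteq> arcs G \<Longrightarrow> bij (path_map (\<lambda>e. inv (f e)) p)"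
  using invertible by (intro bij_path_map) (auto intro: bij_imp_bij_inv)

lemma similarity_path_map_inv:
  assumes "set p \<subseteq> arcs G"
  shows "similarity (inverse s ^ path_weight d p) (path_map (\<lambda>e. inv (f e)) p)"
proof (rule similarity_path_map)
  fix e assume "e \<in> set p"
  then have "e \<in> arcs G" using assms by auto
  then show "similarity (inverse s ^ d e) (inv (f e))"
    using similarity_inv[OF similarity invertible] by (simp add: power_inverse)
qed

lemma scaling_constant_less_1:
  assumes "e \<in> arcs G"
  shows "s < 1"
proof (rule ccontr)
  assume "\<not> s < 1"
  then have "1 \<le> s ^ d e" by (simp add: one_le_power)
  obtain c where c: "c < 1" "c-lipschitz_on UNIV (f e)"
    using contraction[OF assms] by blast
  have "dist (f e 0) (f e 1) = s ^ d e * dist 0 (1 :: real^'n)"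
    using similarity[OF assms] by (auto simp: similarity_def)
  moreover have "dist (f e 0) (f e 1) \<le> c * dist 0 (1 :: real^'n)"
    using c(2) by (rule lipschitz_onD) auto
  moreover have "dist 0 (1 :: real^'n) > 0" by simp
  ultimately have "s ^ d e \<le> c" by (simp only: mult_le_cancel_right)
  with \<open>1 \<le> s ^ d e\<close> c(1) show False by simp
qed

lemma tile_cell:
  assumes "\<sigma> \<in> finite_paths G"
  shows "tile (cell G f A \<sigma>)"
proof -
  obtain u p v where \<sigma>: "\<sigma> = (u, p)" and p: "awalk u p v"
    using assms by (auto simp: finite_paths_def)
  have "v \<in> verts G" "set p \<subseteq> arcs G" using p by auto
  then have "tile (A v)" by (simp add: tile_def attractor_compact attractor_interior)
  then show ?thesis
    using tile_image_similarity[OF similarity_path_map_f bij_path_map_f] \<open>set p \<subseteq> arcs G\<close>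
    by (simp add: \<sigma> cell_eq[OF p])
qed

lemma cell_snoc:
  assumes "awalk u p v" "e \<in> out_arcs G v"
  shows "awalk u (p @ [e]) (head G e)"
    and "cell G f A (u, p @ [e]) = path_map f p ` f e ` A (head G e)"
proof -
  have e: "awalk v [e] (head G e)"
    using assms by (auto simp: awalk_def)
  show "awalk u (p @ [e]) (head G e)" using awalk_appendI[OF assms(1) e] .
  then show "cell G f A (u, p @ [e]) = path_map f p ` f e ` A (head G e)"
    by (simp only: cell_eq path_map_append path_map_Cons path_map_Nil comp_id image_comp)
qed

lemma cell_split:
  assumes "awalk u p v"
  shows "cell G f A (u, p) = (\<Union>e\<in>out_arcs G v. cell G f A (u, p @ [e]))"
proof -
  have v: "v \<in> verts G" using assms by auto
  have "cell G f A (u, p) = path_map f p ` (\<Union>e\<in>out_arcs G v. f e ` A (head G e))"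
    using cell_eq[OF assms] attractor_eq[OF v] by simp
  then show ?thesis using cell_snoc(2)[OF assms] by (simp add: image_UN)
qed

lemma cell_append_subset:
  assumes "awalk u (p @ q) w"
  shows "cell G f A (u, p @ q) \<subseteq> cell G f A (u, p)"
  using assms
proof (induction q arbitrary: w rule: rev_induct)
  case (snoc e q)
  then obtain v where v: "awalk u (p @ q) v" "awalk v [e] w"
    by (metis append_assoc awalk_append_iff)
  then have "e \<in> out_arcs G v" by (auto simp: awalk_def)
  then have "cell G f A (u, p @ q @ [e]) \<subseteq> cell G f A (u, p @ q)"
    using cell_split[OF v(1)] by auto
  with snoc.IH[OF v(1)] show ?case by blast
qed simp

text \<open>Two incomparable paths part at some vertex, along different edges \<open>e\<close> and \<open>e'\<close>. Their cells
  lie in the images of the pieces that \<open>e\<close> and \<open>e'\<close> contribute to the attractor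
  under the map of the common part, and that map preserves emptiness of the interior.\<close>

lemma interior_cell_Int_empty:
  assumes "\<sigma> \<in> finite_paths G" "\<tau> \<in> finite_paths G" "fst \<sigma> = fst \<tau>" "snd \<sigma> \<parallel> snd \<tau>"
  shows "interior (cell G f A \<sigma> \<inter> cell G f A \<tau>) = {}"
proof -
  obtain u p q where \<sigma>: "\<sigma> = (u, p)" and \<tau>: "\<tau> = (u, q)"
    using assms(3) by (metis prod.collapse)
  from parallel_decomp[OF assms(4)] obtain r e p' e' q'
    where ne: "e \<noteq> e'" and p: "p = r @ e # p'" and q: "q = r @ e' # q'"
    by (auto simp: \<sigma> \<tau>)
  obtain w w' where w: "awalk u ((r @ [e]) @ p') w" and w': "awalk u ((r @ [e']) @ q') w'"
    using assms(1,2) by (auto simp: \<sigma> \<tau> p q finite_paths_def)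
  define v where "v = awlast u r"
  have v: "awalk u r v" and ev: "e \<in> out_arcs G v" "e' \<in> out_arcs G v"
    using w w' by (auto simp: v_def awalk_append_iff awalk_Cons_iff)
  have "cell G f A \<sigma> \<inter> cell G f A \<tau> \<subseteq>
      path_map f r ` f e ` A (head G e) \<inter> path_map f r ` f e' ` A (head G e')"
    using cell_append_subset[OF w] cell_append_subset[OF w'] cell_snoc(2)[OF v] ev
    by (auto simp: \<sigma> \<tau> p q)
  also have "\<dots> = path_map f r ` (f e ` A (head G e) \<inter> f e' ` A (head G e'))"
    using v by (intro image_Int[symmetric]) (auto intro!: bij_is_inj bij_path_map_f)
  finally have "interior (cell G f A \<sigma> \<inter> cell G f A \<tau>) \<subseteq>
      interior (path_map f r ` (f e ` A (head G e) \<inter> f e' ` A (head G e')))"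
    by (rule interior_mono)
  moreover have "interior (path_map f r ` (f e ` A (head G e) \<inter> f e' ` A (head G e'))) = {}"
  proof -
    have "set r \<subseteq> arcs G" "v \<in> verts G" using v by auto
    then show ?thesis
      using attractor_nonoverlap[OF _ ev ne]
        interior_image_empty_iff_similarity[OF similarity_path_map_f bij_path_map_f]
      by blast
  qed
  ultimately show ?thesis by blast
qed

text \<open>Every edge has positive weight, so a path that is continued crosses the threshold after
  finitely many edges; the bound on the last edge ensures that it has not crossed it before
  its own last edge, which makes the continuation a first passage.\<close>

lemma cell_subset_Union_first_passage:
  assumes "awalk u p v" "p \<noteq> []" "path_weight d p \<le> N + d (last p)"
  shows "cell G f A (u, p) \<subseteq>
    (\<Union>\<tau>\<in>{\<tau> \<in> first_passage G d u N. prefix p (snd \<tau>)}. cell G f A \<tau>)"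
  using assms
proof (induction "Suc N - path_weight d p" arbitrary: p v rule: less_induct)
  case less
  show ?case
  proof (cases "N < path_weight d p")
    case True
    then have "(u, p) \<in> first_passage G d u N"
      using less.prems by (auto simp: first_passage_def finite_paths_def)
    then show ?thesis by force
  next
    case False
    have "cell G f A (u, p @ [e]) \<subseteq>
        (\<Union>\<tau>\<in>{\<tau> \<in> first_passage G d u N. prefix p (snd \<tau>)}. cell G f A \<tau>)"
      if e: "e \<in> out_arcs G v" for e
    proof -
      have "d e > 0" using e exponent_pos by auto
      then have "cell G f A (u, p @ [e]) \<subseteq>
          (\<Union>\<tau>\<in>{\<tau> \<in> first_passage G d u N. prefix (p @ [e]) (snd \<tau>)}. cell G f A \<tau>)"
        using False by (intro less.hyps[OF _ cell_snoc(1)[OF less.prems(1) e]]) auto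
      then show ?thesis using append_prefixD by fastforce
    qed
    then show ?thesis unfolding cell_split[OF less.prems(1)] by blast
  qed
qed

lemma cell_eq_Union_first_passage:
  assumes "\<sigma> \<in> first_passage G d u M" "M \<le> N"
  shows "cell G f A \<sigma> =
    (\<Union>\<tau>\<in>{\<tau> \<in> first_passage G d u N. prefix (snd \<sigma>) (snd \<tau>)}. cell G f A \<tau>)"
proof
  obtain p v where \<sigma>: "\<sigma> = (u, p)" and p: "awalk u p v"
    using assms(1) by (cases \<sigma>) (auto simp: first_passage_def finite_paths_def)
  show "cell G f A \<sigma> \<subseteq>
      (\<Union>\<tau>\<in>{\<tau> \<in> first_passage G d u N. prefix (snd \<sigma>) (snd \<tau>)}. cell G f A \<tau>)"
    using cell_subset_Union_first_passage[OF p, of N] assms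
    by (auto simp: \<sigma> first_passage_def)
  show "(\<Union>\<tau>\<in>{\<tau> \<in> first_passage G d u N. prefix (snd \<sigma>) (snd \<tau>)}. cell G f A \<tau>) \<subseteq>
      cell G f A \<sigma>"
  proof (rule UN_least)
    fix \<tau> assume "\<tau> \<in> {\<tau> \<in> first_passage G d u N. prefix (snd \<sigma>) (snd \<tau>)}"
    then have "\<tau> \<in> finite_paths G" "fst \<tau> = u" and "prefix p (snd \<tau>)"
      by (auto simp: \<sigma> first_passage_def)
    moreover from \<open>prefix p (snd \<tau>)\<close> obtain q where "snd \<tau> = p @ q"
      by (rule prefixE)
    ultimately have "\<tau> = (u, p @ q)" "awalk u (p @ q) (path_end G (u, p @ q))"
      by (metis prod.collapse, metis prod.collapse finite_paths_iff)
    then show "cell G f A \<tau> \<subseteq> cell G f A \<sigma>"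
      using cell_append_subset by (simp add: \<sigma>)
  qed
qed

section \<open>Balanced tilings\<close>

lemma head_parameter:
  assumes "parameter G \<theta>"
  shows "head G (\<theta> !! k) = param_vertex G \<theta> k"
  using assms
  by (cases k) (auto simp: parameter_def infinite_path_def reverse_graph_def)

lemma parameter_arcs:
  assumes "parameter G \<theta>"
  shows "\<theta> !! k \<in> arcs G" "set (stake k \<theta>) \<subseteq> arcs G"
proof -
  have "sset \<theta> \<subseteq> arcs G"
    using assms by (simp add: parameter_def infinite_path_def reverse_graph_def)
  then have arc: "\<theta> !! i \<in> arcs G" for i using snth_sset by fastforce
  then show "\<theta> !! k \<in> arcs G" .
  show "set (stake k \<theta>) \<subseteq> arcs G" using arc by (auto simp: in_set_conv_nth stake_nth)
qed

lemma path_map_inv_snoc: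
  assumes "e \<in> arcs G"
  shows "path_map (\<lambda>e. inv (f e)) (p @ [e]) (f e x) = path_map (\<lambda>e. inv (f e)) p x"
  using invertible[OF assms] by (simp add: bij_is_inj inv_f_f)

text \<open>Prefixing \<open>\<theta> !! k\<close> to a path of level \<open>k\<close> raises its weight and the threshold by the same
  amount and keeps its last edge; the map added on the expanding side cancels the map of
  the new edge, so the tile stays the same.\<close>

lemma level_tiles_Suc:
  assumes \<theta>: "parameter G \<theta>"
  shows "level_tiles G f A \<theta> (balanced_sequence G d \<theta>) k \<subseteq>
    level_tiles G f A \<theta> (balanced_sequence G d \<theta>) (Suc k)"
proof
  fix t assume "t \<in> level_tiles G f A \<theta> (balanced_sequence G d \<theta>) k"
  then obtain \<sigma> where \<sigma>: "\<sigma> \<in> balanced_sequence G d \<theta> k"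
    and t: "t = path_map (\<lambda>e. inv (f e)) (stake k \<theta>) ` cell G f A \<sigma>"
    by (auto simp: level_tiles_eq_cells)
  obtain p v where \<sigma>_eq: "\<sigma> = (param_vertex G \<theta> k, p)" and p: "awalk (param_vertex G \<theta> k) p v"
    using \<sigma> by (cases \<sigma>) (auto simp: balanced_sequence_def finite_paths_def)
  define e where "e = \<theta> !! k"
  have e: "e \<in> arcs G" using parameter_arcs[OF \<theta>] by (simp add: e_def)
  have ep: "awalk (tail G e) (e # p) v"
    using p e head_parameter[OF \<theta>, of k] by (simp add: awalk_Cons_iff e_def)
  have "(tail G e, e # p) \<in> balanced_sequence G d \<theta> (Suc k)"
    using \<sigma> ep
    by (auto simp: balanced_sequence_eq_first_passage first_passage_def \<sigma>_eq finite_paths_def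
        stake_Suc e_def reverse_graph_def simp del: stake.simps)
  moreover have "t = path_map (\<lambda>e. inv (f e)) (stake (Suc k) \<theta>) ` cell G f A (tail G e, e # p)"
    using path_map_inv_snoc[OF e]
    by (simp add: t \<sigma>_eq cell_eq[OF p] cell_eq[OF ep] stake_Suc e_def[symmetric]
        image_image del: stake.simps path_map_append)
  ultimately show "t \<in> level_tiles G f A \<theta> (balanced_sequence G d \<theta>) (Suc k)"
    by (auto simp: level_tiles_eq_cells)
qed

lemma level_tiles_mono:
  assumes "parameter G \<theta>" "j \<le> k"
  shows "level_tiles G f A \<theta> (balanced_sequence G d \<theta>) j \<subseteq>
    level_tiles G f A \<theta> (balanced_sequence G d \<theta>) k"
  using assms(2) level_tiles_Suc[OF assms(1)] by (rule lift_Suc_mono_le[rotated])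

lemma level_tiles_subset_balanced_tiling:
  "level_tiles G f A \<theta> (balanced_sequence G d \<theta>) k \<subseteq> balanced_tiling G f A d \<theta>"
  by (auto simp: balanced_tiling_def gifs_tiles_def)

lemma balanced_tiling_is_tiling:
  assumes \<theta>: "parameter G \<theta>"
  shows "tiling_of (\<Union>(balanced_tiling G f A d \<theta>)) (balanced_tiling G f A d \<theta>)"
  unfolding tiling_of_def
proof (intro conjI ballI impI refl)
  note similar = similarity_path_map_inv[OF parameter_arcs(2)[OF \<theta>]]
    and bij = bij_path_map_inv[OF parameter_arcs(2)[OF \<theta>]]
  fix t assume "t \<in> balanced_tiling G f A d \<theta>"
  then obtain j where j: "t \<in> level_tiles G f A \<theta> (balanced_sequence G d \<theta>) j"
    by (auto simp: balanced_tiling_def gifs_tiles_def)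
  then show "tile t"
    by (auto simp: level_tiles_eq_cells balanced_sequence_def
        intro!: tile_image_similarity[OF similar bij] tile_cell)
  fix t' assume "t' \<in> balanced_tiling G f A d \<theta>" and ne: "t \<noteq> t'"
  then obtain j' where j': "t' \<in> level_tiles G f A \<theta> (balanced_sequence G d \<theta>) j'"
    by (auto simp: balanced_tiling_def gifs_tiles_def)
  \<comment> \<open>By nestedness the two tiles can be compared inside a single level.\<close>
  define k where "k = max j j'"
  let ?g = "path_map (\<lambda>e. inv (f e)) (stake k \<theta>)"
  have "t \<in> level_tiles G f A \<theta> (balanced_sequence G d \<theta>) k"
    "t' \<in> level_tiles G f A \<theta> (balanced_sequence G d \<theta>) k"
    using j j' level_tiles_mono[OF \<theta>, of j k] level_tiles_mono[OF \<theta>, of j' k]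
    by (auto simp: k_def)
  then obtain \<sigma> \<tau> where
    \<sigma>: "\<sigma> \<in> balanced_sequence G d \<theta> k" "t = ?g ` cell G f A \<sigma>" and
    \<tau>: "\<tau> \<in> balanced_sequence G d \<theta> k" "t' = ?g ` cell G f A \<tau>"
    by (auto simp: level_tiles_eq_cells)
  have "\<sigma> \<noteq> \<tau>" using ne \<sigma> \<tau> by auto
  then have "snd \<sigma> \<parallel> snd \<tau>"
    by (rule first_passage_parallel[OF \<sigma>(1)[unfolded balanced_sequence_eq_first_passage]
          \<tau>(1)[unfolded balanced_sequence_eq_first_passage]])
  then have "interior (cell G f A \<sigma> \<inter> cell G f A \<tau>) = {}"
    using \<sigma>(1) \<tau>(1) by (intro interior_cell_Int_empty) (auto simp: balanced_sequence_def)
  moreover have "t \<inter> t' = ?g ` (cell G f A \<sigma> \<inter> cell G f A \<tau>)"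
    unfolding \<sigma>(2) \<tau>(2) by (rule image_Int[symmetric, OF bij_is_inj[OF bij]])
  ultimately show "interior (t \<inter> t') = {}"
    by (simp add: interior_image_empty_iff_similarity[OF similar bij])
qed

lemma self_similar_balanced_tiling:
  assumes \<theta>: "parameter G \<theta>" and periodic: "\<theta> = \<beta> @- Stream.cycle \<alpha>" "\<alpha> \<noteq> []"
  shows "self_similar (balanced_tiling G f A d \<theta>)"
proof -
  let ?T = "balanced_tiling G f A d \<theta>"
  define g where "g = path_map (\<lambda>e. inv (f e))"
  define l where "l = length \<alpha>"
  have stake_once: "stake (length \<beta> + m) \<theta> = \<beta> @ stake m (Stream.cycle \<alpha>)" for m
    by (simp add: periodic(1) stake_shift)
  have stake_period: "stake (l + m) (Stream.cycle \<alpha>) = \<alpha> @ stake m (Stream.cycle \<alpha>)" for m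
    by (subst Stream.cycle_decomp[OF periodic(2)]) (simp add: l_def stake_shift)
  have stake_twice: "stake (length \<beta> + m + l) \<theta> = \<beta> @ \<alpha> @ stake m (Stream.cycle \<alpha>)" for m
    using stake_once[of "l + m"] stake_period[of m] by (simp add: ac_simps)
  have arcs: "set \<beta> \<subseteq> arcs G" "set \<alpha> \<subseteq> arcs G"
    using parameter_arcs(2)[OF \<theta>, of "length \<beta> + 0 + l"] unfolding stake_twice by auto
  note bij_g = bij_path_map_inv[folded g_def] and similarity_g = similarity_path_map_inv[folded g_def]
  define \<phi> where "\<phi> = g \<beta> \<circ> g \<alpha> \<circ> inv (g \<beta>)"
  define r where "r = inverse s ^ path_weight d \<alpha>"
  have "similarity r \<phi>"
  proof -
    have "similarity (inverse s ^ path_weight d \<beta> * r * inverse (inverse s ^ path_weight d \<beta>)) \<phi>"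
      unfolding \<phi>_def r_def
      by (intro similarity_comp similarity_g similarity_inv bij_g arcs)
    then show ?thesis using scaling_constant_pos by (simp add: field_simps)
  qed
  moreover have "r > 1"
  proof -
    have e: "hd \<alpha> \<in> arcs G" using arcs(2) periodic(2) by (auto simp: subset_iff)
    have "path_weight d \<alpha> > 0"
      using exponent_pos[OF e] periodic(2) by (cases \<alpha>) auto
    moreover have "inverse s > 1"
      using scaling_constant_less_1[OF e] scaling_constant_pos by (rule one_less_inverse[rotated])
    ultimately show ?thesis by (simp add: r_def one_less_power)
  qed
  moreover have "\<exists>T'\<subseteq>?T. tiling_of (\<phi> ` t) T'" if t_in: "t \<in> ?T" for t
  proof -
    obtain j where j: "t \<in> level_tiles G f A \<theta> (balanced_sequence G d \<theta>) j"
      using t_in by (auto simp: balanced_tiling_def gifs_tiles_def)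
    \<comment> \<open>With the successor, \<open>v\<^sub>k\<close> is reached by an edge of the periodic part, so that
      \<open>v\<^bsub>k+l\<^esub> = v\<^sub>k\<close> follows from the equality of the edges that lead there.\<close>
    define k where "k = length \<beta> + Suc j"
    let ?S = "balanced_sequence G d \<theta>"
    have "t \<in> level_tiles G f A \<theta> ?S k"
      using j level_tiles_mono[OF \<theta>, of j k] by (auto simp: k_def)
    then obtain \<sigma> where \<sigma>: "\<sigma> \<in> ?S k" and t: "t = g (stake k \<theta>) ` cell G f A \<sigma>"
      by (auto simp: level_tiles_eq_cells g_def)
    have vertex: "param_vertex G \<theta> (k + l) = param_vertex G \<theta> k"
    proof -
      have "stake (Suc (length \<beta> + j + l)) \<theta> ! (length \<beta> + j + l) =
          stake (Suc (length \<beta> + j)) \<theta> ! (length \<beta> + j)"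
        using stake_twice[of "Suc j"] stake_once[of "Suc j"]
        by (simp add: nth_append l_def del: stake.simps)
      then have "\<theta> !! (length \<beta> + j + l) = \<theta> !! (length \<beta> + j)"
        by (simp add: stake_nth del: stake.simps)
      then show ?thesis by (simp add: k_def)
    qed
    have weight: "path_weight d (stake k \<theta>) \<le> path_weight d (stake (k + l) \<theta>)"
      unfolding k_def stake_twice stake_once by simp
    have shift: "\<phi> ` g (stake k \<theta>) ` X = g (stake (k + l) \<theta>) ` X" for X
    proof -
      have "inv (g \<beta>) \<circ> g \<beta> = id" using bij_g[OF arcs(1)] by (simp add: bij_is_inj)
      then have "inv (g \<beta>) (g \<beta> x) = x" for x by (metis comp_apply id_apply)
      then show ?thesis
        unfolding k_def stake_twice stake_once
        by (simp add: \<phi>_def g_def image_image del: stake.simps)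
    qed
    define T' where "T' = (\<lambda>\<tau>. g (stake (k + l) \<theta>) ` cell G f A \<tau>) `
      {\<tau> \<in> ?S (k + l). prefix (snd \<sigma>) (snd \<tau>)}"
    have "T' \<subseteq> level_tiles G f A \<theta> ?S (k + l)"
      by (auto simp: T'_def level_tiles_eq_cells g_def)
    then have sub: "T' \<subseteq> ?T" using level_tiles_subset_balanced_tiling by blast
    have "cell G f A \<sigma> = (\<Union>\<tau>\<in>{\<tau> \<in> ?S (k + l). prefix (snd \<sigma>) (snd \<tau>)}. cell G f A \<tau>)"
      using \<sigma> weight vertex unfolding balanced_sequence_eq_first_passage
      by (simp add: cell_eq_Union_first_passage)
    then have "\<phi> ` t = \<Union>T'"
      unfolding t shift T'_def by (simp only: image_UN)
    then show ?thesis
      using sub tiling_of_subset[OF balanced_tiling_is_tiling[OF \<theta>] sub] by metis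
  qed
  ultimately show ?thesis
    unfolding self_similar_def using balanced_tiling_is_tiling[OF \<theta>] by blast
qed

end

theorem theorem5:
  fixes G :: "('v, 'e) pre_digraph"
    and f :: "'e \<Rightarrow> real^'n \<Rightarrow> real^'n"
    and A :: "'v \<Rightarrow> (real^'n) set"
    and s :: real
    and d :: "'e \<Rightarrow> nat"
    and \<theta> :: "'e stream"
  assumes "similarity_gifs G f A s d"
    and "parameter G \<theta>"
    and "filling G f A \<theta>"
    and "eventually_periodic G \<theta>"
  shows "self_similar (balanced_tiling G f A d \<theta>)"
proof -
  obtain \<beta> \<alpha> where "\<theta> = \<beta> @- cycle \<alpha>" "\<alpha> \<noteq> []"
    using assms(4) by (auto simp: eventually_periodic_def)
  with assms(1,2) show ?thesis by (rule similarity_gifs.self_similar_balanced_tiling)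
qed

end
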